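(* Let $G(s)$ be a square $n\times n$ transfer-function matrix that is real and strictly proper. Let $\sigma\in\mathbb R$ be a scalar and let $\omega\in\mathbb R$ be such that $j\omega$ is not a pole of (any entry of) $G$ and $I-\sigma G(j\omega)$ is nonsingular. Define $$H_\sigma(j\omega)=(I-\sigma G(j\omega))^{-1}G(j\omega).$$ Then the following hold. 1. $H_\sigma(j\omega)+H_\sigma^H(j\omega)\succeq 0$ if and only if $$G(j\omega)+G^H(j\omega)-2\sigma\, G(j\omega)G^H(j\omega)\succeq 0. \qquad (\ast)$$ 2. If $\sigma\ge 0$, a necessary condition for $(\ast)$ is $$\Re\big(\rho_{G(j\omega)}(x)\big)\ \ge\ \sigma\,\big|\rho_{G(j\omega)}(x)\big|^2\qquad\text{for all }x\in\mathbb C^n,\ x\neq 0 .$$ 3. If $G(j\omega)$ is nonsingular, then $(\ast)$ is equivalent to $$\Re\big(\rho_{G^{-1}(j\omega)}(x)\big)\ \ge\ \sigma\qquad\text{for all }x\in\mathbb C^n,\ x\ne 0 .$$ 4. If $G(j\omega)$ is invertible and $G^{-1}(j\omega)$ is nonsingular and sectorial, i.e. $\rho_{G^{-1}(j\omega)}(x)\neq 0$ for all $x\neq0$, then $(\ast)$ is equivalent to $$\Re\Big(\big(\rho_{G^{-1}(j\omega)}(x)\big)^{-1}\Big)\ \ge\ \sigma\,\Big|\big(\rho_{G^{-1}(j\omega)}(x)\big)^{-1}\Big|^2\qquad\text{for all }x\in\mathbb C^n,\ x\ne 0 .$$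
   Context: Transfer functions are (matrices of) rational functions of $s$ of finite-dimensional linear time-invariant systems; "real" means real coefficients. $j$ is the imaginary unit, $M^H$ is the conjugate transpose, and $M\succeq0$ means Hermitian positive semidefinite. For a square complex matrix $M$ and $x\ne0$, the Rayleigh quotient is $\rho_M(x)=\dfrac{x^HMx}{x^Hx}$. $G^{-1}(j\omega)$ denotes the matrix inverse of $G(j\omega)$. *)

theory Defs
  imports "HOL-Analysis.Analysis" "HOL-Computational_Algebra.Polynomial_Factorial"
    "HOL-Computational_Algebra.Field_as_Ring"
begin

section \<open>Real rational functions and transfer-function matrices\<close>

text \<open>
  A real rational function of \<open>s\<close> is an element of the fraction field \<^typ>\<open>real poly fract\<close>.
  The library function \<^const>\<open>quot_of_fract\<close> yields its reduced representation: the numerator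
  and denominator are coprime and the denominator is monic. In particular, the
  zeros of the denominator are exactly the poles.
\<close>

definition rat_num :: "real poly fract \<Rightarrow> real poly" where
  "rat_num g = fst (quot_of_fract g)"

definition rat_den :: "real poly fract \<Rightarrow> real poly" where
  "rat_den g = snd (quot_of_fract g)"

definition rat_pole :: "real poly fract \<Rightarrow> complex \<Rightarrow> bool" where
  "rat_pole g s \<longleftrightarrow> poly (map_poly complex_of_real (rat_den g)) s = 0"

text \<open>The value is meaningful only where \<open>s\<close> is not a pole of \<open>g\<close>.\<close>

definition rat_eval :: "real poly fract \<Rightarrow> complex \<Rightarrow> complex" where
  "rat_eval g s = poly (map_poly complex_of_real (rat_num g)) s /
                  poly (map_poly complex_of_real (rat_den g)) s"

text \<open>
  Since \<^term>\<open>degree 0\<close> is \<open>0\<close> in the library, the zero function, which is strictly proper, needs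
  its own case.
\<close>

definition rat_strictly_proper :: "real poly fract \<Rightarrow> bool" where
  "rat_strictly_proper g \<longleftrightarrow> g = 0 \<or> degree (rat_num g) < degree (rat_den g)"

definition tf_strictly_proper :: "real poly fract ^ 'n ^ 'm \<Rightarrow> bool" where
  "tf_strictly_proper G \<longleftrightarrow> (\<forall>i j. rat_strictly_proper (G $ i $ j))"

definition tf_pole :: "real poly fract ^ 'n ^ 'm \<Rightarrow> complex \<Rightarrow> bool" where
  "tf_pole G s \<longleftrightarrow> (\<exists>i j. rat_pole (G $ i $ j) s)"

definition tf_eval :: "real poly fract ^ 'n ^ 'm \<Rightarrow> complex \<Rightarrow> complex ^ 'n ^ 'm" where
  "tf_eval G s = (\<chi> i j. rat_eval (G $ i $ j) s)"

lemma rat_eval_Fract: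
  assumes "poly (map_poly complex_of_real q) s \<noteq> 0"
  shows "\<not> rat_pole (Fraction_Field.Fract p q) s"
    and "rat_eval (Fraction_Field.Fract p q) s =
         poly (map_poly complex_of_real p) s / poly (map_poly complex_of_real q) s"
proof -
  have q: "q \<noteq> 0" using assms by auto
  have r: "quot_of_fract (Fraction_Field.Fract p q) = normalize_quot (p, q)"
    using quot_of_fract_quot_to_fract[of "(p, q)"] by (simp add: quot_to_fract_def)
  obtain d where d: "p = fst (normalize_quot (p, q)) * d" "q = snd (normalize_quot (p, q)) * d"
    using normalize_quotE[OF q] by metis
  have m: "map_poly complex_of_real (a * b) = map_poly complex_of_real a * map_poly complex_of_real b"
    for a b :: "real poly"
    by (rule poly_eqI) (simp add: coeff_map_poly coeff_mult)
  have P: "poly (map_poly complex_of_real p) s =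
      poly (map_poly complex_of_real (rat_num (Fraction_Field.Fract p q))) s *
      poly (map_poly complex_of_real d) s"
    by (subst d(1)) (simp add: m rat_num_def r)
  have Q: "poly (map_poly complex_of_real q) s =
      poly (map_poly complex_of_real (rat_den (Fraction_Field.Fract p q))) s *
      poly (map_poly complex_of_real d) s"
    by (subst d(2)) (simp add: m rat_den_def r)
  show "\<not> rat_pole (Fraction_Field.Fract p q) s"
    using assms unfolding Q rat_pole_def by auto
  show "rat_eval (Fraction_Field.Fract p q) s =
         poly (map_poly complex_of_real p) s / poly (map_poly complex_of_real q) s"
    using assms unfolding P Q rat_eval_def by auto
qed


section \<open>Complex matrices\<close>

definition cinner :: "complex ^ 'n \<Rightarrow> complex ^ 'n \<Rightarrow> complex" where
  "cinner x y = (\<Sum>i\<in>UNIV. cnj (x $ i) * y $ i)"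

definition ctranspose :: "complex ^ 'n ^ 'm \<Rightarrow> complex ^ 'm ^ 'n" where
  "ctranspose M = (\<chi> i j. cnj (M $ j $ i))"

lemma cinner_ctranspose:
  fixes M :: "complex ^ 'n ^ 'm"
  shows "cinner x (M *v y) = cinner (ctranspose M *v x) y"
  unfolding cinner_def ctranspose_def matrix_vector_mult_def
  by (simp add: sum_distrib_left sum_distrib_right mult_ac) (rule sum.swap)

definition hermitian :: "complex ^ 'n ^ 'n \<Rightarrow> bool" where
  "hermitian M \<longleftrightarrow> ctranspose M = M"

text \<open>The quadratic form of a Hermitian matrix is real, so its real part is the form itself.\<close>

definition psd :: "complex ^ 'n ^ 'n \<Rightarrow> bool" where
  "psd M \<longleftrightarrow> hermitian M \<and> (\<forall>x. 0 \<le> Re (cinner x (M *v x)))"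

definition rayleigh :: "complex ^ 'n ^ 'n \<Rightarrow> complex ^ 'n \<Rightarrow> complex" where
  "rayleigh M x = cinner x (M *v x) / cinner x x"

definition sectorial :: "complex ^ 'n ^ 'n \<Rightarrow> bool" where
  "sectorial M \<longleftrightarrow> (\<forall>x. x \<noteq> 0 \<longrightarrow> rayleigh M x \<noteq> 0)"

end

theory Submission
  imports Defs
begin

text \<open>
  Write \<open>A = G(j\<omega>)\<close> and let \<open>A*\<close> be its conjugate transpose. Condition \<open>(\<ast>)\<close> says
  \<open>Re \<langle>x, Ax\<rangle> \<ge> \<sigma> |A* x|\<^sup>2\<close> for all \<open>x\<close>. With \<open>B = I - \<sigma> A\<close> one has \<open>B H B* = A B* = A - \<sigma> A A*\<close>, so
  the substitution \<open>x \<mapsto> B* x\<close> turns positivity of \<open>H + H*\<close> into \<open>(\<ast>)\<close>. Cauchy--Schwarz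
  applied to \<open>\<langle>x, Ax\<rangle> = \<langle>A* x, x\<rangle>\<close> gives the necessary condition, and for invertible \<open>A\<close> the
  substitution \<open>y = A* x\<close> turns \<open>(\<ast>)\<close> into \<open>Re \<langle>y, A\<^sup>-\<^sup>1 y\<rangle> \<ge> \<sigma> |y|\<^sup>2\<close>. The last form follows
  from \<open>Re (1/z) = Re z / |z|\<^sup>2\<close>.
\<close>

lemma cinner_add_right: "cinner x (y + z) = cinner x y + cinner x z"
  by (simp add: cinner_def distrib_left sum.distrib)

lemma cinner_diff_right: "cinner x (y - z) = cinner x y - cinner x z"
  by (simp add: cinner_def right_diff_distrib sum_subtractf)

lemma cinner_scaleR_right: "cinner x (r *\<^sub>R y) = of_real r * cinner x y"
  by (simp add: cinner_def scaleR_conv_of_real[symmetric] scaleR_sum_right)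

lemma cnj_cinner: "cnj (cinner x y) = cinner y x"
  by (simp add: cinner_def mult.commute)

lemma Re_cinner_commute: "Re (cinner x y) = Re (cinner y x)"
  by (metis cnj_cinner complex_cnj(1) complex.sel(1) cnj.simps(1))

lemma cinner_self: "cinner x x = of_real ((norm x)\<^sup>2)"
proof -
  have "cinner x x = (\<Sum>i\<in>UNIV. of_real ((cmod (x $ i))\<^sup>2))"
    unfolding cinner_def by (intro sum.cong refl) (metis complex_norm_square mult.commute)
  also have "\<dots> = of_real ((norm x)\<^sup>2)"
    by (simp add: norm_vec_def L2_set_def sum_nonneg)
  finally show ?thesis .
qed

text \<open>Cauchy--Schwarz for the complex form: the triangle inequality reduces it to the real
  inequality for the vectors of coordinate moduli.\<close>

lemma norm_cinner_le: "cmod (cinner x y) \<le> norm x * norm y"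
proof -
  have "cmod (cinner x y) \<le> (\<Sum>i\<in>UNIV. \<bar>norm (x $ i)\<bar> * \<bar>norm (y $ i)\<bar>)"
    unfolding cinner_def by (rule sum_norm_le) (simp add: norm_mult)
  also have "\<dots> \<le> norm x * norm y"
    unfolding norm_vec_def by (rule L2_set_mult_ineq)
  finally show ?thesis .
qed

lemma ctranspose_ctranspose [simp]: "ctranspose (ctranspose M) = M"
  by (simp add: ctranspose_def vec_eq_iff)

lemma ctranspose_add: "ctranspose (M + N) = ctranspose M + ctranspose N"
  by (simp add: ctranspose_def vec_eq_iff)

lemma ctranspose_diff: "ctranspose (M - N) = ctranspose M - ctranspose N"
  by (simp add: ctranspose_def vec_eq_iff)

lemma ctranspose_scaleR: "ctranspose (r *\<^sub>R M) = r *\<^sub>R ctranspose M"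
  by (simp add: ctranspose_def vec_eq_iff)

lemma ctranspose_mult: "ctranspose (M ** N) = ctranspose N ** ctranspose M"
  by (simp add: ctranspose_def vec_eq_iff matrix_matrix_mult_def mult.commute)

lemma ctranspose_mat_1: "ctranspose (mat 1) = mat 1"
  by (auto simp: ctranspose_def vec_eq_iff mat_def)

lemma cinner_ctranspose_right: "cinner x (ctranspose M *v y) = cinner (M *v x) y"
  by (simp add: cinner_ctranspose)

lemma scaleR_matrix_vector_mult:
  fixes M :: "complex ^ 'n ^ 'm"
  shows "(r *\<^sub>R M) *v x = r *\<^sub>R (M *v x)"
  by (simp add: vec_eq_iff matrix_vector_mult_def scaleR_sum_right)

lemma matrix_inv_mult:
  fixes A :: "complex ^ 'n ^ 'n"
  assumes "invertible A"
  shows "A ** matrix_inv A = mat 1" "matrix_inv A ** A = mat 1"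
  using assms unfolding invertible_def matrix_inv_def by (metis (mono_tags, lifting) someI_ex)+

text \<open>The adjoint of the inverse is a right inverse of the adjoint. Both substitutions below
  rest on this: a condition on all vectors may be tested on those of the form
  \<open>ctranspose A *v x\<close>.\<close>

lemma surj_ctranspose:
  fixes A :: "complex ^ 'n ^ 'n"
  assumes "invertible A"
  shows "surj ((*v) (ctranspose A))"
proof (rule surjI)
  fix y
  have "ctranspose A ** ctranspose (matrix_inv A) = mat 1"
    by (simp add: ctranspose_mult[symmetric] matrix_inv_mult assms ctranspose_mat_1)
  then show "ctranspose A *v (ctranspose (matrix_inv A) *v y) = y"
    by (simp add: matrix_vector_mul_assoc)
qed

text \<open>The adjoint contributes the complex conjugate of the form of \<open>H\<close>, so the
  real part doubles; the sum is Hermitian by construction.\<close>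

lemma psd_add_ctranspose_iff:
  "psd (H + ctranspose H) \<longleftrightarrow> (\<forall>x. 0 \<le> Re (cinner x (H *v x)))"
proof -
  have "Re (cinner x ((H + ctranspose H) *v x)) = 2 * Re (cinner x (H *v x))" for x
    by (simp add: matrix_vector_mult_add_rdistrib cinner_add_right cinner_ctranspose_right
        Re_cinner_commute[of "H *v x"])
  then show ?thesis
    by (simp add: psd_def hermitian_def ctranspose_add add.commute)
qed

text \<open>Moving one factor across the form turns that of \<open>A ** ctranspose A\<close> into a
  squared norm, and the common factor 2 cancels. The matrix is Hermitian because
  \<open>\<sigma>\<close> is real.\<close>

lemma psd_star_iff:
  "psd (A + ctranspose A - (2 * \<sigma>) *\<^sub>R (A ** ctranspose A)) \<longleftrightarrow>
   (\<forall>x. \<sigma> * (norm (ctranspose A *v x))\<^sup>2 \<le> Re (cinner x (A *v x)))"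
proof -
  have "Re (cinner x ((A + ctranspose A - (2 * \<sigma>) *\<^sub>R (A ** ctranspose A)) *v x)) =
      2 * (Re (cinner x (A *v x)) - \<sigma> * (norm (ctranspose A *v x))\<^sup>2)" for x
  proof -
    have "cinner x ((A ** ctranspose A) *v x) = of_real ((norm (ctranspose A *v x))\<^sup>2)"
      by (simp add: matrix_vector_mul_assoc[symmetric] cinner_ctranspose cinner_self)
    moreover have "Re (cinner x (ctranspose A *v x)) = Re (cinner x (A *v x))"
      by (simp add: cinner_ctranspose_right Re_cinner_commute[of "A *v x"])
    ultimately show ?thesis
      by (simp add: matrix_vector_mult_add_rdistrib matrix_vector_mult_diff_rdistrib
          scaleR_matrix_vector_mult cinner_add_right cinner_diff_right cinner_scaleR_right
          algebra_simps del: of_real_power)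
  qed
  then show ?thesis
    by (simp add: psd_def hermitian_def ctranspose_add ctranspose_diff ctranspose_scaleR
        ctranspose_mult add.commute)
qed

lemma psd_feedback_iff:
  fixes A :: "complex ^ 'n ^ 'n"
  assumes "invertible (mat 1 - \<sigma> *\<^sub>R A)"
  defines "H \<equiv> matrix_inv (mat 1 - \<sigma> *\<^sub>R A) ** A"
  shows "psd (H + ctranspose H) \<longleftrightarrow>
         psd (A + ctranspose A - (2 * \<sigma>) *\<^sub>R (A ** ctranspose A))"
proof -
  define B where "B = mat 1 - \<sigma> *\<^sub>R A"
  have BH: "B ** H = A"
    using matrix_inv_mult(1)[OF assms(1)] by (simp add: B_def H_def matrix_mul_assoc)
  have form: "Re (cinner (ctranspose B *v y) (H *v (ctranspose B *v y))) =
      Re (cinner y (A *v y)) - \<sigma> * (norm (ctranspose A *v y))\<^sup>2" for y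
  proof -
    have "cinner (ctranspose B *v y) (H *v (ctranspose B *v y)) =
        cinner y ((B ** H) *v (ctranspose B *v y))"
      by (simp add: cinner_ctranspose[symmetric] matrix_vector_mul_assoc[symmetric])
    \<comment> \<open>The inverse has disappeared through \<open>BH\<close>; what remains is to move
      \<open>A\<close> to the left argument and expand the adjoint of \<open>B\<close>.\<close>
    also have "\<dots> = cinner (ctranspose A *v y) (y - \<sigma> *\<^sub>R (ctranspose A *v y))"
      unfolding BH cinner_ctranspose[of y A]
      by (simp add: B_def ctranspose_diff ctranspose_scaleR
          ctranspose_mat_1 matrix_vector_mult_diff_rdistrib scaleR_matrix_vector_mult)
    also have "\<dots> = cinner y (A *v y) - of_real (\<sigma> * (norm (ctranspose A *v y))\<^sup>2)"
      by (simp add: cinner_diff_right cinner_scaleR_right cinner_self cinner_ctranspose)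
    finally show ?thesis by (simp del: of_real_mult of_real_power)
  qed
  \<comment> \<open>Surjectivity of the adjoint of \<open>B\<close> gives the direction from right
    to left.\<close>
  have "psd (H + ctranspose H) \<longleftrightarrow>
      (\<forall>y. 0 \<le> Re (cinner (ctranspose B *v y) (H *v (ctranspose B *v y))))"
    using surj_ctranspose[OF assms(1)] unfolding psd_add_ctranspose_iff B_def surj_def by metis
  then show ?thesis
    by (simp add: form psd_star_iff)
qed

lemma rayleigh_eq: "rayleigh M x = cinner x (M *v x) / of_real ((norm x)\<^sup>2)"
  by (simp add: rayleigh_def cinner_self)

lemma Re_rayleigh: "Re (rayleigh M x) = Re (cinner x (M *v x)) / (norm x)\<^sup>2"
  unfolding rayleigh_eq by (rule Re_divide_of_real)

lemma star_imp_rayleigh: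
  assumes "0 \<le> \<sigma>" "x \<noteq> 0"
    and star: "psd (A + ctranspose A - (2 * \<sigma>) *\<^sub>R (A ** ctranspose A))"
  shows "\<sigma> * (cmod (rayleigh A x))\<^sup>2 \<le> Re (rayleigh A x)"
proof -
  have nx: "0 < norm x" using assms(2) by simp
  have "(cmod (cinner x (A *v x)))\<^sup>2 \<le> (norm (ctranspose A *v x) * norm x)\<^sup>2"
    unfolding cinner_ctranspose by (intro power_mono norm_cinner_le) simp
  then have "(cmod (cinner x (A *v x)) / norm x)\<^sup>2 \<le> (norm (ctranspose A *v x))\<^sup>2"
    using nx by (simp add: power_divide power_mult_distrib divide_le_eq)
  \<comment> \<open>The sign of \<open>\<sigma>\<close> enters here: it keeps the direction of the
    Cauchy--Schwarz bound.\<close>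
  then have "\<sigma> * (cmod (cinner x (A *v x)) / norm x)\<^sup>2 \<le> \<sigma> * (norm (ctranspose A *v x))\<^sup>2"
    using assms(1) by (rule mult_left_mono)
  also have "\<dots> \<le> Re (cinner x (A *v x))"
    using star by (simp add: psd_star_iff)
  finally have "\<sigma> * (cmod (cinner x (A *v x)) / norm x)\<^sup>2 / (norm x)\<^sup>2
      \<le> Re (cinner x (A *v x)) / (norm x)\<^sup>2"
    by (rule divide_right_mono) simp
  moreover have "cmod (rayleigh A x) = cmod (cinner x (A *v x)) / norm x / norm x"
    unfolding rayleigh_eq by (simp add: norm_divide norm_mult power2_eq_square)
  ultimately show ?thesis
    by (simp add: Re_rayleigh power_divide power_mult_distrib)
qed

lemma star_iff_rayleigh_inv:
  fixes A :: "complex ^ 'n ^ 'n"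
  assumes "invertible A"
  shows "psd (A + ctranspose A - (2 * \<sigma>) *\<^sub>R (A ** ctranspose A)) \<longleftrightarrow>
         (\<forall>x. x \<noteq> 0 \<longrightarrow> \<sigma> \<le> Re (rayleigh (matrix_inv A) x))"
proof -
  \<comment> \<open>Cancelling \<open>A\<close> against its inverse leaves the form of the adjoint
    of \<open>A\<close>, the conjugate of the form of \<open>A\<close>; hence the equality is one of
    real parts.\<close>
  have form: "Re (cinner x (A *v x)) =
      Re (cinner (ctranspose A *v x) (matrix_inv A *v (ctranspose A *v x)))" for x
  proof -
    have "cinner (ctranspose A *v x) (matrix_inv A *v (ctranspose A *v x)) =
        cinner x ((A ** matrix_inv A) *v (ctranspose A *v x))"
      by (simp add: cinner_ctranspose[symmetric] matrix_vector_mul_assoc[symmetric])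
    then show ?thesis
      by (simp add: matrix_inv_mult[OF assms] cinner_ctranspose_right
          Re_cinner_commute[of "A *v x"])
  qed
  have "psd (A + ctranspose A - (2 * \<sigma>) *\<^sub>R (A ** ctranspose A)) \<longleftrightarrow>
      (\<forall>y. \<sigma> * (norm y)\<^sup>2 \<le> Re (cinner y (matrix_inv A *v y)))"
    using surj_ctranspose[OF assms] unfolding psd_star_iff form surj_def by metis
  \<comment> \<open>Division by the squared norm handles nonzero \<open>y\<close>; at
    \<open>y = 0\<close> the left inequality reads \<open>0 \<le> 0\<close>.\<close>
  also have "\<dots> \<longleftrightarrow> (\<forall>y. y \<noteq> 0 \<longrightarrow> \<sigma> \<le> Re (rayleigh (matrix_inv A) y))"
    unfolding Re_rayleigh
    by (intro all_cong1) (auto simp: pos_le_divide_eq cinner_def)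
  finally show ?thesis .
qed

lemma Re_inverse_ge_iff:
  assumes "z \<noteq> 0"
  shows "\<sigma> * (cmod (inverse z))\<^sup>2 \<le> Re (inverse z) \<longleftrightarrow> \<sigma> \<le> Re z"
proof -
  have "0 < (cmod z)\<^sup>2" using assms by simp
  moreover have "Re (inverse z) = Re z / (cmod z)\<^sup>2"
    by (simp add: cmod_power2)
  moreover have "(cmod (inverse z))\<^sup>2 = 1 / (cmod z)\<^sup>2"
    by (simp add: inverse_eq_divide norm_divide power_divide)
  ultimately show ?thesis
    by (simp add: divide_le_cancel del: inverse_complex.simps)
qed

theorem theorem1:
  fixes G :: "real poly fract ^ 'n ^ 'n" and \<sigma> \<omega> :: real
  assumes "tf_strictly_proper G"
    and "\<not> tf_pole G (\<i> * complex_of_real \<omega>)"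
    and "invertible (mat 1 - \<sigma> *\<^sub>R tf_eval G (\<i> * complex_of_real \<omega>))"
  shows
    "let G\<omega> = tf_eval G (\<i> * complex_of_real \<omega>);
         H\<omega> = matrix_inv (mat 1 - \<sigma> *\<^sub>R G\<omega>) ** G\<omega>;
         star = psd (G\<omega> + ctranspose G\<omega> - (2 * \<sigma>) *\<^sub>R (G\<omega> ** ctranspose G\<omega>))
     in (psd (H\<omega> + ctranspose H\<omega>) \<longleftrightarrow> star) \<and>
        (0 \<le> \<sigma> \<longrightarrow> star \<longrightarrow>
           (\<forall>x. x \<noteq> 0 \<longrightarrow> Re (rayleigh G\<omega> x) \<ge> \<sigma> * (cmod (rayleigh G\<omega> x))\<^sup>2)) \<and>
        (invertible G\<omega> \<longrightarrow>
           (star \<longleftrightarrow> (\<forall>x. x \<noteq> 0 \<longrightarrow> Re (rayleigh (matrix_inv G\<omega>) x) \<ge> \<sigma>))) \<and>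
        (invertible G\<omega> \<and> invertible (matrix_inv G\<omega>) \<and> sectorial (matrix_inv G\<omega>) \<longrightarrow>
           (star \<longleftrightarrow> (\<forall>x. x \<noteq> 0 \<longrightarrow>
              Re (inverse (rayleigh (matrix_inv G\<omega>) x))
                \<ge> \<sigma> * (cmod (inverse (rayleigh (matrix_inv G\<omega>) x)))\<^sup>2)))"
proof -
  let ?A = "tf_eval G (\<i> * complex_of_real \<omega>)"
  \<comment> \<open>Sectoriality excludes a vanishing quotient, where \<open>inverse 0 = 0\<close>
    would make the second inequality trivially true.\<close>
  have inverse_form: "(\<forall>x. x \<noteq> 0 \<longrightarrow> \<sigma> \<le> Re (rayleigh M x)) \<longleftrightarrow>
      (\<forall>x. x \<noteq> 0 \<longrightarrow> \<sigma> * (cmod (inverse (rayleigh M x)))\<^sup>2 \<le> Re (inverse (rayleigh M x)))"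
    if "sectorial M" for M :: "complex ^ 'n ^ 'n"
    using that Re_inverse_ge_iff unfolding sectorial_def by blast
  show ?thesis
    unfolding Let_def
    using psd_feedback_iff[OF assms(3)] star_imp_rayleigh[of \<sigma> _ ?A]
      star_iff_rayleigh_inv[of ?A \<sigma>] inverse_form[of "matrix_inv ?A"]
    by blast
qed

end
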